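(* Let $Z \in \mathcal{O}^{n,p}_+$ and $S \in \mathrm{sign}(\mathcal{O}^{n,p}_+)$ be arbitrary. Let $W = \max\{0, (\eta Z - \nabla f(Z)) \odot S\} \in \mathbb{R}^{n\times p}_+$ (entrywise maximum), and for every $j \in \{1,\dots,p\}$ let $$\bar i^{(j)} = \min\Big\{ i^* \;\Big|\; i^* \in \operatorname*{arg\,min}_{i \in \mathrm{supp}([S]_{:,j})} [\nabla f(Z) - \eta Z]_{i,j}\Big\},$$ $$\alpha_j = \begin{cases} -\|[W]_{:,j}\|_2, & \text{if } [W]_{:,j} \neq 0,\\ [\nabla f(Z) - \eta Z]_{\bar i^{(j)},j}, & \text{otherwise.}\end{cases}$$ Then the global minimum of the problem $$\min_{X \in \mathcal{O}^{n,p}_+} \ \bar f_Z(X) \quad \text{subject to} \quad \mathrm{supp}(X) \subseteq \mathrm{supp}(S)$$ is $$\bar f_Z^* = f(Z) - \langle \nabla f(Z), Z\rangle + \eta p + \sum_{j=1}^p \alpha_j .$$ Moreover, it is attained at the matrix $\bar X \in \mathcal{O}^{n,p}_+$ whose $j$-th column, for all $j \in \{1,\dots,p\}$, is $$[\bar X]_{:,j} = \begin{cases} [W]_{:,j}/\|[W]_{:,j}\|_2, & \text{if } [W]_{:,j}\neq 0,\\ [I_n]_{:,\bar i^{(j)}}, & \text{otherwise,}\end{cases}$$ where $[I_n]_{:,i}$ denotes the $i$-th unit vector of $\mathbb{R}^n$.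
   Context: Let $1<p<n$ be integers, $\mathcal{O}^{n,p} = \{X\in\mathbb{R}^{n\times p} : X^\top X = I_p\}$ and $\mathcal{O}^{n,p}_+ = \{X \in \mathcal{O}^{n,p} : X \ge 0 \text{ entrywise}\}$. The function $f:\mathbb{R}^{n\times p}\to\mathbb{R}$ is continuously differentiable and its Euclidean gradient $\nabla f$ is Lipschitz continuous over $\mathcal{O}^{n,p}$ with constant $L\ge 0$ (with respect to the Frobenius norm $\|\cdot\|_F$). The constant $\eta$ satisfies $\eta > L$. For $Z\in\mathcal{O}^{n,p}_+$, the proximal linearization of $f$ around $Z$ is $\bar f_Z(X) = f(Z) + \langle \nabla f(Z), X - Z\rangle + \frac{\eta}{2}\|X-Z\|_F^2$, where $\langle A,B\rangle = \mathrm{tr}(A^\top B)$. $[X]_{i,j}$, $[X]_{i,:}$, $[X]_{:,j}$ denote the $(i,j)$ entry, $i$-th row, $j$-th column of $X$; $\mathrm{supp}(X) = \{(i,j) : [X]_{i,j}\ne 0\}$, and $\mathrm{supp}([X]_{:,j}) = \{i : [X]_{i,j}\neq 0\}$. $\mathrm{sign}(X)$ is the entrywise sign matrix (entries in $\{-1,0,1\}$), and $\mathrm{sign}(\mathcal{O}^{n,p}_+) = \{\mathrm{sign}(X) : X\in\mathcal{O}^{n,p}_+\}$. $\odot$ is the Hadamard (entrywise) product. *)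

theory Defs
  imports "HOL-Analysis.Analysis"
begin

text \<open>Matrices with \<open>n\<close> rows and \<open>p\<close> columns have type \<open>real^'p^'n\<close>; the library's inner product
  and norm on this type are the Frobenius ones.\<close>

lemma inner_matrix_eq_trace:
  fixes A B :: "real^'p^'n"
  shows "A \<bullet> B = trace (transpose A ** B)"
proof -
  have "trace (transpose A ** B) = (\<Sum>j\<in>UNIV. \<Sum>i\<in>UNIV. A $ i $ j * B $ i $ j)"
    by (simp add: trace_def matrix_matrix_mult_def transpose_def)
  also have "\<dots> = (\<Sum>i\<in>UNIV. \<Sum>j\<in>UNIV. A $ i $ j * B $ i $ j)"
    by (rule sum.swap)
  finally show ?thesis
    by (simp add: inner_vec_def)
qed

lemma norm_matrix_eq_frobenius:
  fixes A :: "real^'p^'n"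
  shows "norm A = sqrt (\<Sum>i\<in>UNIV. \<Sum>j\<in>UNIV. (A $ i $ j)\<^sup>2)"
  by (simp add: norm_eq_sqrt_inner inner_vec_def power2_eq_square)

definition stiefel :: "(real^'p^'n) set" where
  "stiefel = {X. transpose X ** X = mat 1}"

definition stiefel_nonneg :: "(real^'p^'n) set" where
  "stiefel_nonneg = {X \<in> stiefel. \<forall>i j. 0 \<le> X $ i $ j}"

definition vec_supp :: "real^'n \<Rightarrow> 'n set" where
  "vec_supp v = {i. v $ i \<noteq> 0}"

definition mat_supp :: "real^'p^'n \<Rightarrow> ('n \<times> 'p) set" where
  "mat_supp X = {(i, j). X $ i $ j \<noteq> 0}"

definition mat_sign :: "real^'p^'n \<Rightarrow> real^'p^'n" where
  "mat_sign X = (\<chi> i j. sgn (X $ i $ j))"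

definition hadamard :: "real^'p^'n \<Rightarrow> real^'p^'n \<Rightarrow> real^'p^'n"  (infixl \<open>\<odot>\<close> 70) where
  "A \<odot> B = (\<chi> i j. A $ i $ j * B $ i $ j)"

text \<open>In \<open>prox_lin f G \<eta> Z\<close> the argument \<open>G\<close> stands for the Euclidean gradient of \<open>f\<close>.\<close>

definition prox_lin ::
    "(real^'p^'n \<Rightarrow> real) \<Rightarrow> (real^'p^'n \<Rightarrow> real^'p^'n) \<Rightarrow> real \<Rightarrow> real^'p^'n \<Rightarrow> real^'p^'n \<Rightarrow> real" where
  "prox_lin f G \<eta> Z X = f Z + G Z \<bullet> (X - Z) + \<eta> / 2 * (norm (X - Z))\<^sup>2"

end

theory Submission
  imports Defs
begin

text \<open>The proof rests on two reductions. On the Stiefel manifold the quadratic term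
  \<open>\<eta> / 2 * (norm (X - Z))\<^sup>2\<close> is affine in \<open>X\<close>, because all orthonormal matrices have the same
  Frobenius norm; hence \<open>prox_lin f G \<eta> Z\<close> differs by a constant from the linear function
  \<open>X \<mapsto> (G Z - \<eta> *\<^sub>R Z) \<bullet> X\<close>, which is a sum of one term per column
  (\<open>prox_lin_on_stiefel\<close>). Next, nonnegative vectors are orthogonal exactly when their supports are
  disjoint. The columns of a sign matrix \<open>S\<close> of a nonnegative orthonormal matrix therefore have
  disjoint supports, so for nonnegative matrices supported in \<open>mat_supp S\<close> the orthogonality of
  distinct columns is automatic and the constraint set is a product over the columns
  (\<open>feasible_iff_columns\<close>).

  What remains, separately for every column, is to minimise \<open>c \<bullet> v\<close> over the nonnegative unit
  vectors \<open>v\<close> supported in a given set \<open>T\<close>. If \<open>c\<close> is negative somewhere on \<open>T\<close>, Cauchy--Schwarz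
  against the negative part of \<open>c\<close> on \<open>T\<close> gives the optimum
  (\<open>negative_part_lower_bound\<close>, \<open>normalized_negative_part_attains\<close>). Otherwise \<open>c \<ge> 0\<close> on \<open>T\<close>, and
  since the entries of \<open>v\<close> add up to at least \<open>norm v = 1\<close>, all the mass should sit at the
  smallest entry of \<open>c\<close> on \<open>T\<close> (\<open>least_entry_lower_bound\<close>).\<close>

section \<open>Linear minimisation over nonnegative unit vectors\<close>

definition nonneg_unit :: "'n set \<Rightarrow> (real^'n) set" where
  "nonneg_unit T = {v. norm v = 1 \<and> (\<forall>i. 0 \<le> v $ i) \<and> vec_supp v \<subseteq> T}"

definition negative_part_on :: "'n set \<Rightarrow> real^'n \<Rightarrow> real^'n" where
  "negative_part_on T c = (\<chi> i. if i \<in> T then max 0 (- c $ i) else 0)"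

text \<open>On \<open>T\<close> the vector \<open>c\<close> dominates the negative of its negative part entrywise, and \<open>v\<close>
  is nonnegative and vanishes off \<open>T\<close>, so \<open>c \<bullet> v \<ge> - (negative_part_on T c \<bullet> v)\<close>; then
  Cauchy--Schwarz applies.\<close>

lemma negative_part_lower_bound:
  assumes v: "v \<in> nonneg_unit T"
  shows "- norm (negative_part_on T c) \<le> c \<bullet> v"
proof -
  let ?w = "negative_part_on T c"
  have "- (?w \<bullet> v) = (\<Sum>i\<in>UNIV. - (?w $ i * v $ i))"
    by (simp add: inner_vec_def sum_negf)
  also have "\<dots> \<le> (\<Sum>i\<in>UNIV. c $ i * v $ i)"
  proof (rule sum_mono)
    fix i
    show "- (?w $ i * v $ i) \<le> c $ i * v $ i"
    proof (cases "i \<in> T")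
      case True
      have "- ?w $ i * v $ i \<le> c $ i * v $ i"
        by (rule mult_right_mono) (use True v in \<open>auto simp: negative_part_on_def nonneg_unit_def\<close>)
      then show ?thesis by simp
    next
      case False
      then have "v $ i = 0"
        using v by (auto simp: nonneg_unit_def vec_supp_def)
      then show ?thesis by simp
    qed
  qed
  also have "\<dots> = c \<bullet> v"
    by (simp add: inner_vec_def)
  finally have "- (?w \<bullet> v) \<le> c \<bullet> v" .
  moreover have "?w \<bullet> v \<le> norm ?w"
    using norm_cauchy_schwarz[of ?w v] v by (simp add: nonneg_unit_def)
  ultimately show ?thesis by linarith
qed

text \<open>Wherever the negative part is nonzero it equals \<open>- c\<close>, so \<open>c \<bullet> w = - (w \<bullet> w)\<close> for
  \<open>w = negative_part_on T c\<close>, and the normalised \<open>w\<close> gives equality in the preceding bound.\<close>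

lemma normalized_negative_part_attains:
  fixes T :: "'n::finite set" and c :: "real^'n"
  defines "w \<equiv> negative_part_on T c"
  assumes "w \<noteq> 0"
  shows "w /\<^sub>R norm w \<in> nonneg_unit T" and "c \<bullet> (w /\<^sub>R norm w) = - norm w"
proof -
  show "w /\<^sub>R norm w \<in> nonneg_unit T"
    using \<open>w \<noteq> 0\<close> by (auto simp: nonneg_unit_def vec_supp_def w_def negative_part_on_def)
  have "c \<bullet> w = - (w \<bullet> w)"
    unfolding inner_vec_def sum_negf[symmetric]
    by (rule sum.cong) (auto simp: w_def negative_part_on_def max_def)
  then show "c \<bullet> (w /\<^sub>R norm w) = - norm w"
    using \<open>w \<noteq> 0\<close> by (simp add: dot_square_norm power2_eq_square)
qed

text \<open>The minimum over \<open>T\<close> of the entries of \<open>c\<close> is nonnegative when the negative part vanishes, so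
  it may be multiplied by \<open>(\<Sum>i\<in>UNIV. v $ i) \<ge> norm v = 1\<close>.\<close>

lemma least_entry_lower_bound:
  assumes v: "v \<in> nonneg_unit T"
    and nonneg: "negative_part_on T c = 0"
    and k: "is_arg_min (\<lambda>i. c $ i) (\<lambda>i. i \<in> T) k"
  shows "c $ k \<le> c \<bullet> v"
proof -
  have kT: "k \<in> T" and least: "\<And>i. i \<in> T \<Longrightarrow> c $ k \<le> c $ i"
    using k by (auto simp: is_arg_min_linorder)
  have "0 \<le> c $ k"
    using arg_cong[OF nonneg, of "\<lambda>w. w $ k"] kT
    by (simp add: negative_part_on_def max_def split: if_splits)
  have "1 \<le> (\<Sum>i\<in>UNIV. v $ i)"
    using v norm_le_l1_cart[of v] by (simp add: nonneg_unit_def)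
  then have "c $ k \<le> c $ k * (\<Sum>i\<in>UNIV. v $ i)"
    using \<open>0 \<le> c $ k\<close> by (simp add: mult_le_cancel_left1)
  also have "\<dots> = (\<Sum>i\<in>UNIV. c $ k * v $ i)"
    by (rule sum_distrib_left)
  also have "\<dots> \<le> (\<Sum>i\<in>UNIV. c $ i * v $ i)"
  proof (rule sum_mono)
    fix i
    show "c $ k * v $ i \<le> c $ i * v $ i"
    proof (cases "i \<in> T")
      case True
      then show ?thesis
        using v least by (intro mult_right_mono) (auto simp: nonneg_unit_def)
    next
      case False
      then have "v $ i = 0"
        using v by (auto simp: nonneg_unit_def vec_supp_def)
      then show ?thesis by simp
    qed
  qed
  also have "\<dots> = c \<bullet> v"
    by (simp add: inner_vec_def)
  finally show ?thesis .
qed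

lemma axis_in_nonneg_unit:
  "k \<in> T \<Longrightarrow> axis k 1 \<in> nonneg_unit T"
  by (auto simp: nonneg_unit_def vec_supp_def axis_def norm_axis_1[unfolded axis_def])

section \<open>Decoupling the columns\<close>

lemma column_nth: "column j A $ i = A $ i $ j"
  by (simp add: column_def)

lemma inner_eq_sum_columns:
  fixes A B :: "real^'p^'n"
  shows "A \<bullet> B = (\<Sum>j\<in>UNIV. column j A \<bullet> column j B)"
  by (simp add: inner_vec_def column_nth) (rule sum.swap)

lemma stiefel_iff_columns:
  "X \<in> stiefel \<longleftrightarrow> (\<forall>j k. column j X \<bullet> column k X = (if j = k then 1 else 0))"
  by (simp add: stiefel_def vec_eq_iff matrix_matrix_mult_def transpose_def mat_def
      column_nth inner_vec_def)

lemma norm_square_stiefel: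
  fixes X :: "real^'p^'n"
  assumes "X \<in> stiefel"
  shows "X \<bullet> X = real CARD('p)"
  using assms by (simp add: inner_eq_sum_columns stiefel_iff_columns)

text \<open>Both squared norms in the expansion of \<open>(norm (X - Z))\<^sup>2\<close> equal the number of columns,
  which turns the quadratic term into \<open>\<eta> * CARD('p) - \<eta> * (Z \<bullet> X)\<close>.\<close>

lemma prox_lin_on_stiefel:
  fixes X Z :: "real^'p^'n"
  assumes "X \<in> stiefel" "Z \<in> stiefel"
  shows "prox_lin f G \<eta> Z X = f Z - G Z \<bullet> Z + \<eta> * real CARD('p)
    + (\<Sum>j\<in>UNIV. column j (G Z - \<eta> *\<^sub>R Z) \<bullet> column j X)"
proof -
  have "(norm (X - Z))\<^sup>2 = 2 * real CARD('p) - 2 * (Z \<bullet> X)"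
    using norm_square_stiefel[OF assms(1)] norm_square_stiefel[OF assms(2)]
    by (simp add: power2_norm_eq_inner inner_diff_left inner_diff_right inner_commute)
  then have "\<eta> / 2 * (norm (X - Z))\<^sup>2 = \<eta> * real CARD('p) - \<eta> * (Z \<bullet> X)"
    by (simp only:) (simp add: field_simps)
  then show ?thesis
    unfolding prox_lin_def inner_eq_sum_columns[symmetric]
    by (simp only: inner_diff_left inner_diff_right inner_scaleR_left)
qed

text \<open>A sum of nonnegative products vanishes only if every product does.\<close>

lemma nonneg_orthogonal_iff_disjoint_supp:
  fixes u v :: "real^'n"
  assumes "\<And>i. 0 \<le> u $ i" "\<And>i. 0 \<le> v $ i"
  shows "u \<bullet> v = 0 \<longleftrightarrow> vec_supp u \<inter> vec_supp v = {}"
proof -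
  have "u \<bullet> v = 0 \<longleftrightarrow> (\<forall>i. u $ i * v $ i = 0)"
    using assms by (simp add: inner_vec_def sum_nonneg_eq_0_iff)
  then show ?thesis
    by (auto simp: vec_supp_def)
qed

lemma vec_supp_column_mat_sign:
  "vec_supp (column j (mat_sign Y)) = vec_supp (column j Y)"
  by (auto simp: vec_supp_def column_nth mat_sign_def sgn_zero_iff)

lemma mat_supp_subset_iff_columns:
  "mat_supp X \<subseteq> mat_supp S \<longleftrightarrow> (\<forall>j. vec_supp (column j X) \<subseteq> vec_supp (column j S))"
  by (auto simp: mat_supp_def vec_supp_def column_nth)

lemma sign_stiefel_nonneg_disjoint_supp:
  assumes "S \<in> mat_sign ` stiefel_nonneg" "j \<noteq> k"
  shows "vec_supp (column j S) \<inter> vec_supp (column k S) = {}"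
proof -
  obtain Y where Y: "Y \<in> stiefel_nonneg" and S: "S = mat_sign Y"
    using assms(1) by blast
  have "column j Y \<bullet> column k Y = 0"
    using Y assms(2) by (simp add: stiefel_nonneg_def stiefel_iff_columns)
  moreover have "0 \<le> column l Y $ i" for l i
    using Y by (simp add: stiefel_nonneg_def column_nth)
  ultimately show ?thesis
    unfolding S vec_supp_column_mat_sign
    using nonneg_orthogonal_iff_disjoint_supp by blast
qed

lemma sign_stiefel_nonneg_supp_nonempty:
  assumes "S \<in> mat_sign ` stiefel_nonneg"
  shows "vec_supp (column j S) \<noteq> {}"
proof -
  obtain Y where Y: "Y \<in> stiefel_nonneg" and S: "S = mat_sign Y"
    using assms by blast
  have "column j Y \<bullet> column j Y = 1"
    using Y by (simp add: stiefel_nonneg_def stiefel_iff_columns)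
  then have "column j Y \<noteq> 0" by auto
  then show ?thesis
    unfolding S vec_supp_column_mat_sign by (auto simp: vec_supp_def vec_eq_iff)
qed

lemma sign_stiefel_nonneg_entry:
  assumes "S \<in> mat_sign ` stiefel_nonneg"
  shows "S $ i $ j = (if i \<in> vec_supp (column j S) then 1 else 0)"
proof -
  obtain Y where Y: "Y \<in> stiefel_nonneg" and S: "S = mat_sign Y"
    using assms by blast
  have "0 \<le> Y $ i $ j"
    using Y by (simp add: stiefel_nonneg_def)
  then show ?thesis
    unfolding S by (auto simp: mat_sign_def vec_supp_def column_nth sgn_real_def)
qed

text \<open>The supports of the columns of \<open>S\<close> are disjoint, so columns of \<open>X\<close> chosen independently
  within them are already orthogonal.\<close>

lemma feasible_iff_columns:
  fixes X S :: "real^'p^'n"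
  assumes S: "S \<in> mat_sign ` stiefel_nonneg"
  shows "X \<in> stiefel_nonneg \<and> mat_supp X \<subseteq> mat_supp S
    \<longleftrightarrow> (\<forall>j. column j X \<in> nonneg_unit (vec_supp (column j S)))"
proof
  assume X: "X \<in> stiefel_nonneg \<and> mat_supp X \<subseteq> mat_supp S"
  then show "\<forall>j. column j X \<in> nonneg_unit (vec_supp (column j S))"
    by (auto simp: nonneg_unit_def norm_eq_1 stiefel_nonneg_def stiefel_iff_columns
        mat_supp_subset_iff_columns) (simp add: column_nth)
next
  assume cols: "\<forall>j. column j X \<in> nonneg_unit (vec_supp (column j S))"
  then have nonneg: "0 \<le> column j X $ i"
    and supp: "vec_supp (column j X) \<subseteq> vec_supp (column j S)"
    and unit: "column j X \<bullet> column j X = 1" for i j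
    by (auto simp: nonneg_unit_def norm_eq_1)
  have "column j X \<bullet> column k X = 0" if "j \<noteq> k" for j k
  proof -
    have "vec_supp (column j X) \<inter> vec_supp (column k X) = {}"
      using sign_stiefel_nonneg_disjoint_supp[OF S that] supp by blast
    then show ?thesis
      using nonneg_orthogonal_iff_disjoint_supp nonneg by blast
  qed
  then have "X \<in> stiefel"
    using unit by (simp add: stiefel_iff_columns)
  moreover have "0 \<le> X $ i $ j" for i j
    using nonneg[of j i] by (simp add: column_nth)
  ultimately show "X \<in> stiefel_nonneg \<and> mat_supp X \<subseteq> mat_supp S"
    using supp by (simp add: stiefel_nonneg_def mat_supp_subset_iff_columns)
qed

section \<open>The global minimum of the proximal linearization\<close>

theorem proposition3p2:
  fixes f :: "real^'p^'n::{finite,linorder} \<Rightarrow> real"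
    and grad_f :: "real^'p^'n::{finite,linorder} \<Rightarrow> real^'p^'n::{finite,linorder}"
    and L \<eta> :: real
    and Z S W Xbar :: "real^'p^'n::{finite,linorder}"
    and ibar :: "'p \<Rightarrow> 'n::{finite,linorder}"
    and \<alpha> :: "'p \<Rightarrow> real"
  assumes dims: "1 < CARD('p)" "CARD('p) < CARD('n)"
    and grad: "\<And>X. GDERIV f X :> grad_f X"
    and grad_cont: "continuous_on UNIV grad_f"
    and L_nonneg: "0 \<le> L"
    and grad_lipschitz: "L-lipschitz_on stiefel grad_f"
    and eta: "L < \<eta>"
    and Z: "Z \<in> stiefel_nonneg"
    and S: "S \<in> mat_sign ` stiefel_nonneg"
    and W: "W = (\<chi> i j. max 0 (((\<eta> *\<^sub>R Z - grad_f Z) \<odot> S) $ i $ j))"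
    and ibar: "\<And>j. ibar j =
      Min {i. is_arg_min (\<lambda>i. (grad_f Z - \<eta> *\<^sub>R Z) $ i $ j) (\<lambda>i. i \<in> vec_supp (column j S)) i}"
    and alpha: "\<And>j. \<alpha> j =
      (if column j W \<noteq> 0 then - norm (column j W) else (grad_f Z - \<eta> *\<^sub>R Z) $ (ibar j) $ j)"
    and Xbar: "\<And>j. column j Xbar =
      (if column j W \<noteq> 0 then column j W /\<^sub>R norm (column j W) else axis (ibar j) 1)"
  shows "Xbar \<in> stiefel_nonneg
    \<and> is_arg_min (prox_lin f grad_f \<eta> Z)
        (\<lambda>X. X \<in> stiefel_nonneg \<and> mat_supp X \<subseteq> mat_supp S) Xbar
    \<and> prox_lin f grad_f \<eta> Z Xbar
        = f Z - grad_f Z \<bullet> Z + \<eta> * real CARD('p) + (\<Sum>j\<in>UNIV. \<alpha> j)"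
proof -
  let ?M = "grad_f Z - \<eta> *\<^sub>R Z"
  let ?T = "\<lambda>j. vec_supp (column j S)"
  let ?const = "f Z - grad_f Z \<bullet> Z + \<eta> * real CARD('p)"
  let ?feasible = "\<lambda>X. X \<in> stiefel_nonneg \<and> mat_supp X \<subseteq> mat_supp S"
  have W_col: "column j W = negative_part_on (?T j) (column j ?M)" for j
    using sign_stiefel_nonneg_entry[OF S, of _ j]
    by (simp add: W vec_eq_iff negative_part_on_def hadamard_def column_nth)
  have ibar_arg_min: "is_arg_min (\<lambda>i. column j ?M $ i) (\<lambda>i. i \<in> ?T j) (ibar j)" for j
  proof -
    let ?A = "{i. is_arg_min (\<lambda>i. ?M $ i $ j) (\<lambda>i. i \<in> ?T j) i}"
    have "?A \<noteq> {}"
      using ex_is_arg_min_if_finite[OF finite sign_stiefel_nonneg_supp_nonempty[OF S, of j],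
          of "\<lambda>i. ?M $ i $ j"]
      by blast
    then have "ibar j \<in> ?A"
      unfolding ibar by (intro Min_in) simp_all
    then show ?thesis
      by (simp add: column_nth)
  qed
  have lower: "\<alpha> j \<le> column j ?M \<bullet> v" if "v \<in> nonneg_unit (?T j)" for j v
  proof (cases "column j W = 0")
    case True
    then show ?thesis
      using least_entry_lower_bound[OF that _ ibar_arg_min] by (simp add: alpha W_col column_nth)
  next
    case False
    then show ?thesis
      using negative_part_lower_bound[OF that] by (simp add: alpha W_col)
  qed
  have attained: "column j Xbar \<in> nonneg_unit (?T j) \<and> column j ?M \<bullet> column j Xbar = \<alpha> j" for j
  proof (cases "column j W = 0")
    case True
    have "ibar j \<in> ?T j"
      using ibar_arg_min by (simp add: is_arg_min_def)
    then show ?thesis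
      using True axis_in_nonneg_unit by (simp add: Xbar alpha inner_axis) (simp add: column_nth)
  next
    case False
    then show ?thesis
      using normalized_negative_part_attains[of "?T j" "column j ?M"]
      unfolding Xbar alpha W_col by simp
  qed
  have objective: "prox_lin f grad_f \<eta> Z X = ?const + (\<Sum>j\<in>UNIV. column j ?M \<bullet> column j X)"
    if "X \<in> stiefel_nonneg" for X
    using that Z by (simp add: prox_lin_on_stiefel stiefel_nonneg_def)
  have feasible: "?feasible Xbar"
    using attained by (simp add: feasible_iff_columns[OF S])
  have optimum: "prox_lin f grad_f \<eta> Z Xbar = ?const + (\<Sum>j\<in>UNIV. \<alpha> j)"
    using feasible attained by (simp add: objective)
  have "prox_lin f grad_f \<eta> Z Xbar \<le> prox_lin f grad_f \<eta> Z X" if X: "?feasible X" for X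
  proof -
    have "(\<Sum>j\<in>UNIV. \<alpha> j) \<le> (\<Sum>j\<in>UNIV. column j ?M \<bullet> column j X)"
      using X lower by (intro sum_mono) (simp add: feasible_iff_columns[OF S])
    then show ?thesis
      using X by (simp add: optimum objective)
  qed
  then show ?thesis
    using feasible optimum by (simp add: is_arg_min_linorder)
qed

end
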